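(* For heterogeneous users, the combined mechanism has price of anarchy $$PoA_{ag}=\inf_{\theta_1,\theta_2,c_H,Q_1}\frac{SW_{ag}}{SW(x_H^* )}\ \ge\ 0.7$$ (improving on the value $1/2$ of the price of anarchy of either the side-payment or the content-restriction mechanism used alone).
   Context: A unit mass of non-atomic users chooses between path $H$ (travel cost $c_H>0$) and path $L$ (cost $0$). Half of the users have valuation $\theta_1>0$ and half $\theta_2>\theta_1$; $\theta_0=(\theta_1+\theta_2)/2$. $Q_1:[0,1]\to[0,\infty)$ is continuous, concave, nondecreasing, $Q_1(0)=0$; $Q(x,b)=Q_1(x)+Q_1(b-x)$; $Q(\cdot,1)$ is strictly increasing on $[0,1/2]$. The unrestricted social optimum is $SW(x_H^* )=\max_{0\le x\le1}\{\theta_0Q(x,1)-xc_H\}$. Combined mechanism: each $L$-user pays $g(x_H)$ and gets only the fraction $a\in[0,1]$ of the content; each $H$-user receives $\frac{b-x_H}{x_H}g(x_H)$, where $b$ is the participating mass. $SW_{ag}$ is the optimal social welfare achieved by this mechanism at equilibria satisfying individual rationality, which is the larger of the following two values: (full participation) $$\sup_{x\in(0,1/2],\,a\in[0,1]}\ \Big(x\theta_2+\big((\tfrac12-x)\theta_2+\tfrac12\theta_1\big)a\Big)Q(x,1)-xc_H\quad\text{s.t.}\quad \theta_1aQ(x,1)-(c_H-(1-a)\theta_2Q(x,1))x\ge0,$$ (in this case type-2 users are indifferent between the paths, all type-1 users take $L$, and the constraint is type-1 individual rationality); and (half participation, only type-2 users, $a=1$) $$\max_{x\in[0,1/2]}\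 \tfrac12\theta_2Q(x,\tfrac12)-xc_H .$$ *)

theory Defs
  imports "HOL-Analysis.Analysis"
begin

(* Only the values of Q1 on [0,1] matter; Q1 is modelled as a total function constrained there. *)

definition total_content :: "(real \<Rightarrow> real) \<Rightarrow> real \<Rightarrow> real \<Rightarrow> real" where
  "total_content Q1 x b = Q1 x + Q1 (b - x)"

definition admissible_Q1 :: "(real \<Rightarrow> real) \<Rightarrow> bool" where
  "admissible_Q1 Q1 \<longleftrightarrow>
     (\<forall>x\<in>{0..1}. 0 \<le> Q1 x) \<and>
     continuous_on {0..1} Q1 \<and>
     concave_on {0..1} Q1 \<and>
     mono_on {0..1} Q1 \<and>
     Q1 0 = 0 \<and>
     strict_mono_on {0..1/2} (\<lambda>x. total_content Q1 x 1)"

definition SW_opt :: "real \<Rightarrow> real \<Rightarrow> real \<Rightarrow> (real \<Rightarrow> real) \<Rightarrow> real" where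
  "SW_opt \<theta>1 \<theta>2 cH Q1 = (SUP x\<in>{0..1}. (\<theta>1 + \<theta>2) / 2 * total_content Q1 x 1 - x * cH)"

definition full_welfare ::
    "real \<Rightarrow> real \<Rightarrow> real \<Rightarrow> (real \<Rightarrow> real) \<Rightarrow> real \<Rightarrow> real \<Rightarrow> real" where
  "full_welfare \<theta>1 \<theta>2 cH Q1 x a =
     (x * \<theta>2 + ((1/2 - x) * \<theta>2 + 1/2 * \<theta>1) * a) * total_content Q1 x 1 - x * cH"

definition full_feasible ::
    "real \<Rightarrow> real \<Rightarrow> real \<Rightarrow> (real \<Rightarrow> real) \<Rightarrow> (real \<times> real) set" where
  "full_feasible \<theta>1 \<theta>2 cH Q1 =
     {(x, a). x \<in> {0<..1/2} \<and> a \<in> {0..1} \<and>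
        \<theta>1 * a * total_content Q1 x 1 - (cH - (1 - a) * \<theta>2 * total_content Q1 x 1) * x \<ge> 0}"

definition half_welfare :: "real \<Rightarrow> real \<Rightarrow> (real \<Rightarrow> real) \<Rightarrow> real \<Rightarrow> real" where
  "half_welfare \<theta>2 cH Q1 x = 1/2 * \<theta>2 * total_content Q1 x (1/2) - x * cH"

definition SW_ag_full :: "real \<Rightarrow> real \<Rightarrow> real \<Rightarrow> (real \<Rightarrow> real) \<Rightarrow> real" where
  "SW_ag_full \<theta>1 \<theta>2 cH Q1 =
     (SUP (x, a)\<in>full_feasible \<theta>1 \<theta>2 cH Q1. full_welfare \<theta>1 \<theta>2 cH Q1 x a)"

definition SW_ag_half :: "real \<Rightarrow> real \<Rightarrow> (real \<Rightarrow> real) \<Rightarrow> real" where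
  "SW_ag_half \<theta>2 cH Q1 = (SUP x\<in>{0..1/2}. half_welfare \<theta>2 cH Q1 x)"

definition SW_ag :: "real \<Rightarrow> real \<Rightarrow> real \<Rightarrow> (real \<Rightarrow> real) \<Rightarrow> real" where
  "SW_ag \<theta>1 \<theta>2 cH Q1 = max (SW_ag_full \<theta>1 \<theta>2 cH Q1) (SW_ag_half \<theta>2 cH Q1)"

definition instance_ratios :: "real set" where
  "instance_ratios =
     {SW_ag \<theta>1 \<theta>2 cH Q1 / SW_opt \<theta>1 \<theta>2 cH Q1 | \<theta>1 \<theta>2 cH Q1.
        0 < \<theta>1 \<and> \<theta>1 < \<theta>2 \<and> 0 < cH \<and> admissible_Q1 Q1}"

definition PoA_ag :: real where
  "PoA_ag = Inf instance_ratios"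


(* Origin of the optimisation problems above: payoffs under the combined mechanism when the
   participating mass is b, of which x takes H, and each L-user pays g. *)

definition payoff_H :: "real \<Rightarrow> real \<Rightarrow> (real \<Rightarrow> real) \<Rightarrow> real \<Rightarrow> real \<Rightarrow> real \<Rightarrow> real" where
  "payoff_H \<theta> cH Q1 b x g = \<theta> * total_content Q1 x b - cH + (b - x) / x * g"

definition payoff_L :: "real \<Rightarrow> real \<Rightarrow> (real \<Rightarrow> real) \<Rightarrow> real \<Rightarrow> real \<Rightarrow> real \<Rightarrow> real" where
  "payoff_L \<theta> a Q1 b x g = \<theta> * a * total_content Q1 x b - g"

lemma type2_indifferent_iff:
  assumes "0 < x"
  shows "payoff_H \<theta>2 cH Q1 1 x g = payoff_L \<theta>2 a Q1 1 x g \<longleftrightarrow>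
         g = (cH - (1 - a) * \<theta>2 * total_content Q1 x 1) * x"
  using assms by (simp add: payoff_H_def payoff_L_def field_simps)

lemma full_feasible_iff:
  "(x, a) \<in> full_feasible \<theta>1 \<theta>2 cH Q1 \<longleftrightarrow>
     x \<in> {0<..1/2} \<and> a \<in> {0..1} \<and>
     (\<exists>g. payoff_H \<theta>2 cH Q1 1 x g = payoff_L \<theta>2 a Q1 1 x g \<and> 0 \<le> payoff_L \<theta>1 a Q1 1 x g)"
  by (auto simp: full_feasible_def type2_indifferent_iff) (simp_all add: payoff_L_def)

lemma type1_prefers_L:
  assumes "0 < x" "a \<le> 1" "\<theta>1 \<le> \<theta>2" "0 \<le> total_content Q1 x 1"
    and "payoff_H \<theta>2 cH Q1 1 x g = payoff_L \<theta>2 a Q1 1 x g"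
  shows "payoff_H \<theta>1 cH Q1 1 x g \<le> payoff_L \<theta>1 a Q1 1 x g"
proof -
  have "0 \<le> (\<theta>2 - \<theta>1) * (1 - a) * total_content Q1 x 1"
    using assms by simp
  then show ?thesis
    using assms(5) by (simp add: payoff_H_def payoff_L_def algebra_simps)
qed

lemma full_welfare_eq:
  assumes "0 < x"
  shows "x * payoff_H \<theta>2 cH Q1 1 x g + (1/2 - x) * payoff_L \<theta>2 a Q1 1 x g
           + 1/2 * payoff_L \<theta>1 a Q1 1 x g = full_welfare \<theta>1 \<theta>2 cH Q1 x a"
  using assms by (simp add: payoff_H_def payoff_L_def full_welfare_def field_simps)

lemma half_welfare_eq:
  assumes "0 < x"
  shows "x * payoff_H \<theta>2 cH Q1 (1/2) x g + (1/2 - x) * payoff_L \<theta>2 1 Q1 (1/2) x g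
           = half_welfare \<theta>2 cH Q1 x"
  using assms by (simp add: payoff_H_def payoff_L_def half_welfare_def field_simps)


(* The suprema and the infimum over the reals are taken over nonempty, suitably bounded sets,
   and the denominators are positive. *)

lemma continuous_on_total_content:
  assumes "continuous_on {0..1} Q1" "b \<le> 1"
  shows "continuous_on {0..b} (\<lambda>x. total_content Q1 x b)"
  unfolding total_content_def
proof (intro continuous_on_add)
  show "continuous_on {0..b} Q1"
    using assms by (auto intro: continuous_on_subset)
  show "continuous_on {0..b} (\<lambda>x. Q1 (b - x))"
    by (rule continuous_on_compose2[OF assms(1)]) (use assms(2) in \<open>auto intro!: continuous_intros\<close>)
qed

lemma SUP_attained_Icc:
  fixes f :: "real \<Rightarrow> real"
  assumes "continuous_on {0..b} f" "0 \<le> b"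
  shows "\<exists>x\<in>{0..b}. (SUP y\<in>{0..b}. f y) = f x \<and> (\<forall>y\<in>{0..b}. f y \<le> f x)"
proof -
  obtain x where x: "x \<in> {0..b}" "\<And>y. y \<in> {0..b} \<Longrightarrow> f y \<le> f x"
    using continuous_attains_sup[of "{0..b}" f] assms by auto
  have "(SUP y\<in>{0..b}. f y) = f x"
    by (rule cSup_eq_maximum) (use x in auto)
  with x show ?thesis by blast
qed

lemma SW_opt_attained:
  assumes "admissible_Q1 Q1"
  shows "\<exists>x\<in>{0..1}. SW_opt \<theta>1 \<theta>2 cH Q1 = (\<theta>1 + \<theta>2) / 2 * total_content Q1 x 1 - x * cH \<and>
           (\<forall>y\<in>{0..1}. (\<theta>1 + \<theta>2) / 2 * total_content Q1 y 1 - y * cH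
                       \<le> (\<theta>1 + \<theta>2) / 2 * total_content Q1 x 1 - x * cH)"
  unfolding SW_opt_def
  by (rule SUP_attained_Icc)
    (use assms in \<open>auto simp: admissible_Q1_def intro!: continuous_intros continuous_on_total_content\<close>)

lemma SW_ag_half_attained:
  assumes "admissible_Q1 Q1"
  shows "\<exists>x\<in>{0..1/2}. SW_ag_half \<theta>2 cH Q1 = half_welfare \<theta>2 cH Q1 x \<and>
           (\<forall>y\<in>{0..1/2}. half_welfare \<theta>2 cH Q1 y \<le> half_welfare \<theta>2 cH Q1 x)"
  unfolding SW_ag_half_def half_welfare_def
  by (rule SUP_attained_Icc)
    (use assms in \<open>auto simp: admissible_Q1_def intro!: continuous_intros continuous_on_total_content\<close>)

lemma Q1_one_pos:
  assumes "admissible_Q1 Q1"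
  shows "0 < Q1 1"
proof -
  have "total_content Q1 0 1 < total_content Q1 (1/2) 1"
    using strict_mono_onD[of "{0..1/2}" "\<lambda>x. total_content Q1 x 1" 0 "1/2"] assms
    by (simp add: admissible_Q1_def)
  moreover have "Q1 (1/2) \<le> Q1 1"
    using mono_onD[of "{0..1}" Q1 "1/2" 1] assms by (simp add: admissible_Q1_def)
  moreover have "0 \<le> Q1 1" "Q1 0 = 0"
    using assms by (auto simp: admissible_Q1_def)
  ultimately show ?thesis by (simp add: total_content_def)
qed

lemma SW_opt_pos:
  assumes "0 < \<theta>1" "\<theta>1 < \<theta>2" "admissible_Q1 Q1"
  shows "0 < SW_opt \<theta>1 \<theta>2 cH Q1"
proof -
  have "0 < (\<theta>1 + \<theta>2) / 2 * total_content Q1 0 1 - 0 * cH"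
    using assms Q1_one_pos[OF assms(3)] by (simp add: total_content_def admissible_Q1_def)
  also have "\<dots> \<le> SW_opt \<theta>1 \<theta>2 cH Q1"
    using SW_opt_attained[OF assms(3), of \<theta>1 \<theta>2 cH] by (metis atLeastAtMost_iff order_refl zero_le_one)
  finally show ?thesis .
qed

lemma total_content_bounds:
  assumes "admissible_Q1 Q1" "x \<in> {0..1/2}"
  shows "Q1 1 \<le> total_content Q1 x 1" "total_content Q1 x 1 \<le> 2 * Q1 1"
proof -
  have sm: "strict_mono_on {0..1/2} (\<lambda>x. total_content Q1 x 1)" and m: "mono_on {0..1} Q1"
    and z: "Q1 0 = 0" using assms(1) by (auto simp: admissible_Q1_def)
  have "total_content Q1 0 1 \<le> total_content Q1 x 1"
    using strict_mono_onD[OF sm, of 0 x] assms(2) by (cases "x = 0") auto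
  then show "Q1 1 \<le> total_content Q1 x 1" by (simp add: total_content_def z)
  show "total_content Q1 x 1 \<le> 2 * Q1 1"
    using mono_onD[OF m, of x 1] mono_onD[OF m, of "1 - x" 1] assms(2) by (simp add: total_content_def)
qed

lemma full_feasible_nonempty:
  assumes "0 < \<theta>1" "0 < cH" "admissible_Q1 Q1"
  shows "full_feasible \<theta>1 \<theta>2 cH Q1 \<noteq> {}"
proof -
  define x where "x = min (1/2) (\<theta>1 * Q1 1 / cH)"
  have x: "x \<in> {0<..1/2}" "x * cH \<le> \<theta>1 * Q1 1"
    using assms Q1_one_pos[OF assms(3)] by (auto simp: x_def min_def field_simps)
  have "\<theta>1 * Q1 1 \<le> \<theta>1 * total_content Q1 x 1"
    using total_content_bounds(1)[OF assms(3), of x] x assms by auto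
  then have "(x, 1) \<in> full_feasible \<theta>1 \<theta>2 cH Q1"
    using x by (auto simp: full_feasible_def algebra_simps)
  then show ?thesis by blast
qed

lemma full_welfare_bdd_above:
  assumes "0 < \<theta>1" "\<theta>1 < \<theta>2" "0 < cH" "admissible_Q1 Q1"
  shows "bdd_above ((\<lambda>(x, a). full_welfare \<theta>1 \<theta>2 cH Q1 x a) ` full_feasible \<theta>1 \<theta>2 cH Q1)"
proof (rule bdd_aboveI2, clarify)
  fix x a assume "(x, a) \<in> full_feasible \<theta>1 \<theta>2 cH Q1"
  then have xa: "0 < x" "x \<le> 1/2" "0 \<le> a" "a \<le> 1" by (auto simp: full_feasible_def)
  let ?C = "total_content Q1 x 1"
  have C: "0 \<le> ?C" "?C \<le> 2 * Q1 1"
    using total_content_bounds[OF assms(4), of x] Q1_one_pos[OF assms(4)] xa by auto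
  have k: "0 \<le> (1/2 - x) * \<theta>2 + 1/2 * \<theta>1" using xa assms by simp
  have "x * \<theta>2 + ((1/2 - x) * \<theta>2 + 1/2 * \<theta>1) * a \<le> (\<theta>1 + \<theta>2) / 2"
    using mult_left_mono[OF xa(4) k] by (simp add: algebra_simps)
  then have "(x * \<theta>2 + ((1/2 - x) * \<theta>2 + 1/2 * \<theta>1) * a) * ?C \<le> (\<theta>1 + \<theta>2) / 2 * (2 * Q1 1)"
    using C assms by (intro mult_mono) auto
  moreover have "0 \<le> x * cH" using xa assms by simp
  ultimately show "full_welfare \<theta>1 \<theta>2 cH Q1 x a \<le> (\<theta>1 + \<theta>2) / 2 * (2 * Q1 1)"
    unfolding full_welfare_def by linarith
qed

lemma instance_ratios_bdd_below: "bdd_below instance_ratios"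
proof (rule bdd_belowI)
  fix r assume "r \<in> instance_ratios"
  then obtain \<theta>1 \<theta>2 cH Q1 where r: "r = SW_ag \<theta>1 \<theta>2 cH Q1 / SW_opt \<theta>1 \<theta>2 cH Q1"
    and A: "0 < \<theta>1" "\<theta>1 < \<theta>2" "0 < cH" "admissible_Q1 Q1"
    by (auto simp: instance_ratios_def)
  have "0 \<le> half_welfare \<theta>2 cH Q1 0"
    using A by (auto simp: half_welfare_def total_content_def admissible_Q1_def)
  also have "\<dots> \<le> SW_ag_half \<theta>2 cH Q1"
    using SW_ag_half_attained[OF A(4), of \<theta>2 cH] by fastforce
  finally have "0 \<le> SW_ag \<theta>1 \<theta>2 cH Q1" by (simp add: SW_ag_def)
  then show "0 \<le> r" using SW_opt_pos[OF A(1,2,4), of cH] by (simp add: r)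
qed

lemma admissible_Q1_example: "admissible_Q1 (\<lambda>x. min x (1/2))"
  unfolding admissible_Q1_def
proof (intro conjI)
  show "concave_on {0..1} (\<lambda>x::real. min x (1/2))"
    unfolding concave_on_iff
  proof (intro conjI ballI allI impI)
    fix x y u v :: real
    assume "0 \<le> u" "0 \<le> v" "u + v = 1"
    moreover from this have "u * min x (1/2) \<le> u * x" "v * min y (1/2) \<le> v * y"
      "u * min x (1/2) \<le> u * (1/2)" "v * min y (1/2) \<le> v * (1/2)"
      by (intro mult_left_mono; simp)+
    ultimately show "u * min x (1/2) + v * min y (1/2) \<le> min (u *\<^sub>R x + v *\<^sub>R y) (1/2)"
      by auto
  qed auto
  show "strict_mono_on {0..1/2} (\<lambda>x. total_content (\<lambda>x. min x (1/2)) x 1)"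
    by (rule strict_mono_onI) (auto simp: total_content_def min_def)
qed (auto intro!: continuous_intros mono_onI)

lemma instance_ratios_nonempty: "instance_ratios \<noteq> {}"
proof -
  have "0 < (1::real) \<and> (1::real) < 2 \<and> 0 < (1::real) \<and> admissible_Q1 (\<lambda>x. min x (1/2))"
    using admissible_Q1_example by simp
  then show ?thesis unfolding instance_ratios_def by blast
qed

end

theory Submission
  imports Defs
begin

text \<open>
  The welfare of any \<open>x \<in> {0..1/2}\<close> is compared with three equilibria: full participation with
  almost nobody on \<open>H\<close>; full participation at the same \<open>x\<close>, with \<open>a = 1\<close> if that is individually
  rational and with the \<open>a\<close> that makes type-1 rationality tight otherwise; and half participation
  at the same \<open>x\<close>. After normalising \<open>\<theta>\<^sub>0 = Q\<^sub>1(1) = 1\<close>, monotonicity and concavity bound the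
  content available at half participation from below, and the claim becomes a polynomial
  inequality. At least one equilibrium is good enough: for small \<open>x\<close> the half-participation content
  is large, whereas for large \<open>x\<close> restricting the content of the \<open>L\<close>-users costs little.
\<close>

section \<open>The normalised polynomial inequality\<close>

text \<open>
  Normalised data: \<open>t = \<theta>\<^sub>1/\<theta>\<^sub>0\<close>, \<open>Q = Q(x,1)/Q\<^sub>1(1)\<close>, \<open>C = x c\<^sub>H/(\<theta>\<^sub>0 Q\<^sub>1(1))\<close>, \<open>p = Q\<^sub>1(x)/Q\<^sub>1(1)\<close>,
  \<open>q = Q\<^sub>1(1/2 - x)/Q\<^sub>1(1)\<close>. The last three hypotheses say that \<open>a = 1\<close> is not individually
  rational at \<open>x\<close> and that the other two full-participation equilibria fall short of \<open>7/10\<close> of the welfare \<open>Q - C\<close>; \<open>(1 - t) * a * Q\<close> is the full welfare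
  when type-1 rationality is tight.
\<close>

lemma normalised_half_welfare_ge:
  fixes x Q C t p q :: real
  assumes x: "0 < x" "x \<le> 1/2" and Q: "0 < Q" "Q \<le> 2" and t: "0 < t" "t < 1"
    and p: "Q - 1 \<le> p"
    and q1: "x \<le> 1/4 \<Longrightarrow> (1 - 2 * x) * q \<ge> 1/2 * p + (1/2 - 2 * x) * (Q - p)"
    and q2: "1/4 \<le> x \<Longrightarrow> x * q \<ge> (1/2 - x) * p"
    and ir: "t * Q < C" and zero: "1 < 0.7 * (Q - C)"
    and restr: "\<And>a. 0 \<le> a \<Longrightarrow> a \<le> 1 \<Longrightarrow> t * a * Q + (1 - a) * (2 - t) * x * Q = C \<Longrightarrow>
      (1 - t) * a * Q < 0.7 * (Q - C)"
  shows "0.7 * (Q - C) \<le> (2 - t) / 2 * (p + q) - C"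
proof (rule ccontr)
  assume half: "\<not> ?thesis"
  have Cle: "C < Q - 10/7" using zero by simp
  have C0: "0 < C" using mult_pos_pos[OF t(1) Q(1)] ir by linarith
  have "t * Q < 2/7 * Q"
    \<comment> \<open>Since \<open>Q \<le> 2\<close>, \<open>Q - 10/7 \<le> 2/7 * Q\<close>.\<close>
    using ir Cle Q by linarith
  then have t27: "t < 2/7" using Q by simp
  have D: "0 < (0.3 - t) * Q + 0.7 * C"
    using t27 Q C0 by (intro add_pos_pos mult_pos_pos) auto
  have N: "(2 - t) * x * ((0.3 - t) * Q + 0.7 * C) < (1 - 0.3 * t) * C - 0.7 * t * Q"
    \<comment> \<open>otherwise the \<open>a\<close> that makes type-1 rationality tight contradicts \<open>restr\<close>\<close>
  proof (rule ccontr)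
    \<comment> \<open>Type-1 tightness reads \<open>t * Q + (1 - a) * u * Q = C\<close>; solving it
      for \<open>a\<close> gives the witness below.\<close>
    define u where "u = (2 - t) * x - t"
    assume "\<not> ?thesis"
    then have *: "(1 - t) * (C - t * Q) \<le> u * ((0.3 - t) * Q + 0.7 * C)"
      by (simp add: u_def field_simps)
    have "0 < (1 - t) * (C - t * Q)" using ir t by simp
    from this * have "0 < u * ((0.3 - t) * Q + 0.7 * C)" by (rule less_le_trans)
    then have u: "0 < u" using D by (rule zero_less_mult_pos2)
    have **: "0.7 * (Q - C) * u \<le> (1 - t) * (u * Q + t * Q - C)"
      using * by (simp add: field_simps)
    have "0 < 0.7 * (Q - C) * u" using u zero by simp
    from this ** have "0 < (1 - t) * (u * Q + t * Q - C)" by (rule less_le_trans)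
    then have v: "0 < u * Q + t * Q - C" using t by (simp add: zero_less_mult_iff)
    define a where "a = (u * Q + t * Q - C) / (Q * u)"
    have Qu: "0 < Q * u" using u Q by simp
    have a: "0 \<le> a" "a \<le> 1" using v Qu ir by (auto simp: a_def field_simps)
    have aQ: "a * (Q * u) = u * Q + t * Q - C"
      unfolding a_def using less_imp_neq[OF Qu] by (intro nonzero_eq_divide_eq[THEN iffD1]) auto
    have "t * a * Q + (1 - a) * (2 - t) * x * Q = C"
      using aQ by (simp add: u_def algebra_simps)
    from restr[OF a this] have "((1 - t) * a * Q) * u < 0.7 * (Q - C) * u"
      using u by (rule mult_strict_right_mono)
    moreover have "((1 - t) * a * Q) * u = (1 - t) * (u * Q + t * Q - C)"
      using aQ by (simp add: mult.assoc)
    ultimately show False using ** by simp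
  qed
  then have N': "x * (0.6 * Q + 1.4 * C)
      + t * ((0.3 * C + 0.7 * Q) - x * (2.3 * Q + 0.7 * C)) + x * t\<^sup>2 * Q < C"
    by (simp add: field_simps power2_eq_square)
  \<comment> \<open>The left side of \<open>N\<close> increases with \<open>x\<close>. At
    \<open>0.3\<close> its \<open>t\<close>-terms have the favourable sign and leave
    \<open>9 * Q < 29 * C\<close>, against \<open>C < 2/7 * Q\<close>.\<close>
  have x3: "x < 0.3"
  proof (rule ccontr)
    assume "\<not> x < 0.3"
    then have "(2 - t) * 0.3 * ((0.3 - t) * Q + 0.7 * C) \<le> (2 - t) * x * ((0.3 - t) * Q + 0.7 * C)"
      using t D by (intro mult_right_mono mult_left_mono) auto
    with N have "0.3 * (0.6 * Q + 1.4 * C) + (t * Q / 100 + 9 * (t * C) / 100 + 3 * (t * t * Q) / 10) < C"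
      by (simp add: field_simps)
    moreover have "0 \<le> t * Q / 100 + 9 * (t * C) / 100 + 3 * (t * t * Q) / 10"
      using t Q C0 by (intro add_nonneg_nonneg) auto
    ultimately have "0.3 * (0.6 * Q + 1.4 * C) < C" by linarith
    then have "9 * Q < 29 * C" by (simp add: field_simps)
    then show False using Cle Q by linarith
  qed
  have lin: "x * (0.6 * Q + 1.4 * C) < C"
  proof -
    have "x * (2.3 * Q + 0.7 * C) \<le> 0.3 * (2.3 * Q + 0.7 * C)"
      using x3 Q C0 by (intro mult_right_mono) auto
    then have "0 \<le> t * ((0.3 * C + 0.7 * Q) - x * (2.3 * Q + 0.7 * C))"
      using t Q C0 by (intro mult_nonneg_nonneg) auto
    moreover have "0 \<le> x * t\<^sup>2 * Q" using x Q by simp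
    ultimately show ?thesis using N' by linarith
  qed
  have half': "(2 - t) / 2 * r < 0.7 * Q + 0.3 * C" if "r \<le> p + q" for r
  proof -
    have "(2 - t) / 2 * r \<le> (2 - t) / 2 * (p + q)"
      using that t by (intro mult_left_mono) auto
    also have "\<dots> < 0.7 * (Q - C) + C" using half by (simp only: not_le less_diff_eq diff_less_eq)
    also have "\<dots> = 0.7 * Q + 0.3 * C" by (simp add: field_simps)
    finally show ?thesis .
  qed
  \<comment> \<open>Adding \<open>(1 - 2 * x) * p\<close> to \<open>q1\<close> makes the total
    coefficient of \<open>p\<close> equal to 1, so \<open>Q - 1 \<le> p\<close> applies
    directly.\<close>
  have small: "(1 - 2 * x) * (p + q) \<ge> (3/2 - 2 * x) * Q - 1" if "x \<le> 1/4"
    using q1[OF that] p by (simp add: field_simps)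
  \<comment> \<open>At \<open>1/4\<close> the concavity bound changes from \<open>q1\<close> to
    \<open>q2\<close>. Before that, \<open>small\<close> bounds \<open>p + q\<close> by
    \<open>Q - (1 - Q/2) / (1 - 2 * x)\<close>, nonincreasing in \<open>x\<close>: each case takes
    it at its right endpoint, and from \<open>1/6\<close> on \<open>lin\<close> is taken at the left
    endpoint.\<close>
  consider "x \<le> 1/6" | "1/6 \<le> x" "x \<le> 1/5" | "1/5 \<le> x" "x \<le> 1/4" | "1/4 \<le> x" by linarith
  then show False
  proof cases
    case 1
    have "0 \<le> (2 - Q) * (1/4 - 3/2 * x)" using 1 Q by (intro mult_nonneg_nonneg) auto
    then have "(1 - 2 * x) * (7/4 * Q - 3/2) \<le> (1 - 2 * x) * (p + q)"
      using small 1 by (simp add: field_simps)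
    then have "7/4 * Q - 3/2 \<le> p + q" using 1 by simp
    from half'[OF this] have "7/4 * Q - 3/2 - 7/8 * (t * Q) + 3/4 * t < 0.7 * Q + 0.3 * C"
      by (simp add: field_simps)
    moreover have "t * Q \<le> t * 2" using t Q by simp
    ultimately show False using ir Cle Q t by linarith
  next
    case 2
    have "0 \<le> (2 - Q) * (1/6 - 5/6 * x)" using 2 Q by (intro mult_nonneg_nonneg) auto
    then have "(1 - 2 * x) * (11/6 * Q - 5/3) \<le> (1 - 2 * x) * (p + q)"
      using small 2 by (simp add: field_simps)
    then have "11/6 * Q - 5/3 \<le> p + q" using 2 by simp
    from half'[OF this] have "11/6 * Q - 5/3 - 11/12 * (t * Q) + 5/6 * t < 0.7 * Q + 0.3 * C"
      by (simp add: field_simps)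
    moreover have "t * Q \<le> t * 2" using t Q by simp
    moreover have "1/6 * (0.6 * Q + 1.4 * C) \<le> x * (0.6 * Q + 1.4 * C)"
      using 2 Q C0 by (intro mult_right_mono) auto
    from le_less_trans[OF this lin] have "3 * Q < 23 * C" by (simp add: field_simps)
    ultimately show False using ir Cle Q t by linarith
  next
    case 3
    have "0 \<le> (2 - Q) * (1/2 - 2 * x)" using 3 Q by (intro mult_nonneg_nonneg) auto
    then have "(1 - 2 * x) * (2 * Q - 2) \<le> (1 - 2 * x) * (p + q)"
      using small 3 by (simp add: field_simps)
    then have "2 * Q - 2 \<le> p + q" using 3 by simp
    from half'[OF this] have "2 * Q - 2 - t * Q + t < 0.7 * Q + 0.3 * C"
      by (simp add: field_simps)
    moreover have "t * Q \<le> t * 2" using t Q by simp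
    moreover have "1/5 * (0.6 * Q + 1.4 * C) \<le> x * (0.6 * Q + 1.4 * C)"
      using 3 Q C0 by (intro mult_right_mono) auto
    from le_less_trans[OF this lin] have "Q < 6 * C" by (simp add: field_simps)
    ultimately show False using ir Cle Q t by linarith
  next
    case 4
    have "1/4 * (0.6 * Q + 1.4 * C) \<le> x * (0.6 * Q + 1.4 * C)"
      using 4 Q C0 by (intro mult_right_mono) auto
    from le_less_trans[OF this lin] have "3 * Q < 13 * C" by (simp add: field_simps)
    then have Q2: "13/7 < Q" using Cle by linarith
    have "Q - 1 \<le> (p + q) * (2 * x)"
      using q2[OF 4] p by (simp add: field_simps)
    then have "(Q - 1) / (2 * x) \<le> p + q" using x by (simp add: pos_divide_le_eq)
    from half'[OF this] have "(1 - t / 2) * (Q - 1) < x * (1.4 * Q + 0.6 * C)"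
      using x by (simp add: field_simps)
    also have "\<dots> \<le> x * (2 * Q - 6/7)" using x Cle by (intro mult_left_mono) auto
    finally have "(1 - t / 2) * (Q - 1) < x * (2 * Q - 6/7)" .
    \<comment> \<open>\<open>(Q - 1) / (2 * Q - 6/7)\<close> increases with \<open>Q\<close> and
      equals \<open>0.3\<close> at \<open>Q = 13/7\<close>.\<close>
    moreover have "(1 - t / 2) * (0.3 * (2 * Q - 6/7)) \<le> (1 - t / 2) * (Q - 1)"
      using t Q2 by (intro mult_left_mono) auto
    ultimately have "(0.3 * (1 - t / 2)) * (2 * Q - 6/7) < x * (2 * Q - 6/7)"
      by (simp only: mult.commute mult.left_commute mult.assoc)
    then have xt: "0.3 * (1 - t / 2) < x"
      by (rule mult_right_less_imp_less) (use Q2 in simp)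
    \<comment> \<open>\<open>G\<close> increases in \<open>C\<close> and \<open>Q\<close> and decreases in \<open>x\<close>; \<open>G1\<close>, \<open>G2\<close>, \<open>G3\<close> are the changes when
      \<open>C\<close>, \<open>Q\<close>, \<open>x\<close> are successively replaced by \<open>Q - 10/7\<close>, \<open>2\<close>, \<open>0.3 * (1 - t / 2)\<close>\<close>
    define G where "G = C - (x * (0.6 * Q + 1.4 * C)
      + t * ((0.3 * C + 0.7 * Q) - x * (2.3 * Q + 0.7 * C)) + x * t\<^sup>2 * Q)"
    define G1 where "G1 = (Q - 10/7 - C) * (1 - 1.4 * x - 0.3 * t + 0.7 * (t * x))"
    define G2 where "G2 = (2 - Q) * (1 - 2 * x - t * (1 - 3 * x) - x * t\<^sup>2)"
    define G3 where "G3 = (x - 0.3 * (1 - t / 2)) * (2 - 5 * t + 2 * t\<^sup>2)"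
    have "0 < G" using N' by (simp only: G_def diff_gt_0_iff_gt)
    moreover have "0 \<le> G1"
      unfolding G1_def
      using Cle x3 t27 x t by (intro mult_nonneg_nonneg add_nonneg_nonneg) auto
    moreover have "0 \<le> G2"
    proof -
      have "t * (1 - 3 * x) \<le> 2/7 * (1/4)" using t27 4 t x3 by (intro mult_mono) auto
      moreover have "x * t\<^sup>2 \<le> 0.3 * 1\<^sup>2" using x3 x t by (intro mult_mono power_mono) auto
      ultimately show ?thesis
        unfolding G2_def using Q x3 by (intro mult_nonneg_nonneg) auto
    qed
    moreover have "0 \<le> G3"
      unfolding G3_def using xt t27 by (intro mult_nonneg_nonneg) auto
    ultimately have "0 < 700 * (G + G1 + G2 + G3)" by simp
    also have "\<dots> = 160 * t + 210 * t^3 - 945 * t\<^sup>2 - 20"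
      unfolding G_def G1_def G2_def G3_def
      by (simp add: field_simps power2_eq_square power3_eq_cube)
    finally have "20 + 945 * t\<^sup>2 < 160 * t + 210 * t^3" by simp
    moreover have "t^3 \<le> t\<^sup>2" using t by (simp add: power_decreasing)
    \<comment> \<open>After \<open>t^3 \<le> t\<^sup>2\<close> it remains to refute
      \<open>20 + 735 * t\<^sup>2 < 160 * t\<close>; this square bounds the linear term.\<close>
    moreover have "0 \<le> (20 * t - 3)\<^sup>2" by simp
    then have "120 * t \<le> 400 * t\<^sup>2 + 9" by (simp add: power2_eq_square algebra_simps)
    moreover have "0 \<le> t\<^sup>2" by simp
    ultimately show False using \<open>t^3 \<le> t\<^sup>2\<close> by argo
  qed
qed

section \<open>Reduction to the normalised inequality\<close>

lemma
  assumes \<theta>: "0 < \<theta>1" "\<theta>1 < \<theta>2" and c: "0 < cH" and adm: "admissible_Q1 Q1"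
  shows full_welfare_le_SW_ag:
      "(y, a) \<in> full_feasible \<theta>1 \<theta>2 cH Q1 \<Longrightarrow> full_welfare \<theta>1 \<theta>2 cH Q1 y a \<le> SW_ag \<theta>1 \<theta>2 cH Q1"
    and half_welfare_le_SW_ag:
      "y \<in> {0..1/2} \<Longrightarrow> half_welfare \<theta>2 cH Q1 y \<le> SW_ag \<theta>1 \<theta>2 cH Q1"
proof -
  show "full_welfare \<theta>1 \<theta>2 cH Q1 y a \<le> SW_ag \<theta>1 \<theta>2 cH Q1"
    if "(y, a) \<in> full_feasible \<theta>1 \<theta>2 cH Q1"
    using cSUP_upper[OF that full_welfare_bdd_above[OF \<theta> c adm]]
    by (simp add: SW_ag_def SW_ag_full_def)
  show "half_welfare \<theta>2 cH Q1 y \<le> SW_ag \<theta>1 \<theta>2 cH Q1" if "y \<in> {0..1/2}"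
    using SW_ag_half_attained[OF adm, of \<theta>2 cH] that by (fastforce simp: SW_ag_def)
qed

text \<open>Feasibility demands positive mass on \<open>H\<close>, so this value is only approached:
  with \<open>a = 1\<close>, a mass \<open>y\<close> small enough for type-1 rationality costs at
  most \<open>e\<close>.\<close>

lemma zero_H_welfare_le_SW_ag:
  assumes \<theta>: "0 < \<theta>1" "\<theta>1 < \<theta>2" and c: "0 < cH" and adm: "admissible_Q1 Q1"
  shows "(\<theta>1 + \<theta>2) / 2 * Q1 1 \<le> SW_ag \<theta>1 \<theta>2 cH Q1"
proof (rule field_le_epsilon)
  fix e :: real assume e: "0 < e"
  define y where "y = min (1/2) (min (\<theta>1 * Q1 1 / cH) (e / cH))"
  have y: "y \<in> {0<..1/2}" "y * cH \<le> \<theta>1 * Q1 1" "y * cH \<le> e"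
    using assms e Q1_one_pos[OF adm] by (auto simp: y_def min_def field_simps)
  have Q: "Q1 1 \<le> total_content Q1 y 1"
    using total_content_bounds(1)[OF adm, of y] y by auto
  then have "\<theta>1 * Q1 1 \<le> \<theta>1 * total_content Q1 y 1" using \<theta> by simp
  then have "(y, 1) \<in> full_feasible \<theta>1 \<theta>2 cH Q1"
    using y by (auto simp: full_feasible_def algebra_simps)
  from full_welfare_le_SW_ag[OF assms this]
  have "(\<theta>1 + \<theta>2) / 2 * total_content Q1 y 1 - y * cH \<le> SW_ag \<theta>1 \<theta>2 cH Q1"
    by (simp add: full_welfare_def algebra_simps add_divide_distrib)
  moreover have "(\<theta>1 + \<theta>2) / 2 * Q1 1 \<le> (\<theta>1 + \<theta>2) / 2 * total_content Q1 y 1"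
    using Q \<theta> by (intro mult_left_mono) auto
  ultimately show "(\<theta>1 + \<theta>2) / 2 * Q1 1 \<le> SW_ag \<theta>1 \<theta>2 cH Q1 + e" using y by linarith
qed

text \<open>Jensen's inequality with weights that need not sum to 1, which avoids dividing by
  \<open>1 - 2 * x\<close> or \<open>x\<close> in its two uses.\<close>

lemma concave_on_weighted:
  fixes f :: "real \<Rightarrow> real"
  assumes f: "concave_on S f" and xy: "x \<in> S" "y \<in> S" and uv: "0 \<le> u" "0 \<le> v" "0 < u + v"
    and z: "(u + v) * z = u * x + v * y"
  shows "u * f x + v * f y \<le> (u + v) * f z"
proof -
  have "u / (u + v) * f x + v / (u + v) * f y \<le> f (u / (u + v) * x + v / (u + v) * y)"
    using concave_on_iff[THEN iffD1, OF f] xy uv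
    by (simp del: times_divide_eq_left flip: add_divide_distrib)
  moreover have "u / (u + v) * x + v / (u + v) * y = z"
    using uv by (simp flip: add_divide_distrib z)
  ultimately have "(u * f x + v * f y) / (u + v) \<le> f z" by (simp add: add_divide_distrib)
  then show ?thesis using uv by (simp add: divide_le_eq mult.commute)
qed

lemma SW_ag_approx:
  assumes \<theta>: "0 < \<theta>1" "\<theta>1 < \<theta>2" and c: "0 < cH" and adm: "admissible_Q1 Q1"
    and x: "x \<in> {0..1/2}"
  shows "0.7 * ((\<theta>1 + \<theta>2) / 2 * total_content Q1 x 1 - x * cH) \<le> SW_ag \<theta>1 \<theta>2 cH Q1"
proof (rule ccontr)
  let ?S = "SW_ag \<theta>1 \<theta>2 cH Q1"
  define m where "m = (\<theta>1 + \<theta>2) / 2"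
  define T where "T = m * Q1 1"
  define t where "t = \<theta>1 / m"
  define Q where "Q = total_content Q1 x 1 / Q1 1"
  define C where "C = x * cH / T"
  define p where "p = Q1 x / Q1 1"
  define q where "q = Q1 (1/2 - x) / Q1 1"
  have conc: "concave_on {0..1} Q1" and mono: "mono_on {0..1} Q1"
    and Q10: "Q1 0 = 0" using adm by (auto simp: admissible_Q1_def)
  have k: "0 < Q1 1" by (rule Q1_one_pos[OF adm])
  have m: "0 < m" using \<theta> by (simp add: m_def)
  have T: "0 < T" using m k by (simp add: T_def)
  have th1: "\<theta>1 = t * m" using m by (simp add: t_def)
  have th2: "\<theta>2 = (2 - t) * m" using th1 by (simp add: m_def algebra_simps)
  have tc: "total_content Q1 x 1 = Q * Q1 1" using k by (simp add: Q_def)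
  have xc: "x * cH = C * T" using less_imp_neq[OF T] by (simp add: C_def)
  have pk: "Q1 x = p * Q1 1" "Q1 (1/2 - x) = q * Q1 1" using k by (simp_all add: p_def q_def)
  have pk': "Q1 (1 - x) = (Q - p) * Q1 1" using tc pk by (simp add: total_content_def algebra_simps)
  have opt: "m * total_content Q1 x 1 - x * cH = (Q - C) * T"
    unfolding tc xc by (simp add: T_def algebra_simps)
  have full: "full_welfare \<theta>1 \<theta>2 cH Q1 x a =
      ((x * (2 - t) + ((1/2 - x) * (2 - t) + t / 2) * a) * Q - C) * T" for a
    unfolding full_welfare_def tc xc by (simp add: th1 th2 T_def field_simps)
  have feas: "(x, a) \<in> full_feasible \<theta>1 \<theta>2 cH Q1 \<longleftrightarrow>
      0 < x \<and> 0 \<le> a \<and> a \<le> 1 \<and> C \<le> t * a * Q + (1 - a) * (2 - t) * x * Q" for a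
  proof -
    have "\<theta>1 * a * total_content Q1 x 1 - (cH - (1 - a) * \<theta>2 * total_content Q1 x 1) * x
        = \<theta>1 * a * total_content Q1 x 1 - x * cH + (1 - a) * \<theta>2 * total_content Q1 x 1 * x"
      by (simp add: algebra_simps)
    also have "\<dots> = (t * a * Q + (1 - a) * (2 - t) * x * Q - C) * T"
      unfolding tc xc by (simp add: th1 th2 T_def algebra_simps)
    finally have "0 \<le> \<theta>1 * a * total_content Q1 x 1 - (cH - (1 - a) * \<theta>2 * total_content Q1 x 1) * x
        \<longleftrightarrow> C \<le> t * a * Q + (1 - a) * (2 - t) * x * Q"
      using T by (simp only: zero_le_mult_iff) linarith
    then show ?thesis using x unfolding full_feasible_def by auto
  qed
  have half: "half_welfare \<theta>2 cH Q1 x = ((2 - t) / 2 * (p + q) - C) * T"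
    unfolding half_welfare_def total_content_def xc pk by (simp add: th2 T_def algebra_simps)
  assume "\<not> ?thesis"
  then have less: "?S < 0.7 * (Q - C) * T"
    using opt unfolding m_def mult.assoc by (metis not_le)
  have "1 * T < 0.7 * (Q - C) * T"
    using zero_H_welfare_le_SW_ag[OF \<theta> c adm, folded m_def T_def] less by linarith
  then have zero: "1 < 0.7 * (Q - C)" using T by (simp only: mult_less_cancel_right_pos)
  have fullx: "(x * (2 - t) + ((1/2 - x) * (2 - t) + t / 2) * a) * Q - C < 0.7 * (Q - C)"
    if "0 < x" "0 \<le> a" "a \<le> 1" "C \<le> t * a * Q + (1 - a) * (2 - t) * x * Q" for a
  proof -
    have "((x * (2 - t) + ((1/2 - x) * (2 - t) + t / 2) * a) * Q - C) * T < 0.7 * (Q - C) * T"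
      using full_welfare_le_SW_ag[OF \<theta> c adm, of x a] that less by (simp add: feas full)
    then show ?thesis using T by (simp only: mult_less_cancel_right_pos)
  qed
  have "((2 - t) / 2 * (p + q) - C) * T < 0.7 * (Q - C) * T"
    using half_welfare_le_SW_ag[OF \<theta> c adm x] less by (simp add: half)
  then have halfx: "(2 - t) / 2 * (p + q) - C < 0.7 * (Q - C)"
    using T by (simp only: mult_less_cancel_right_pos)
  have "x \<noteq> 0"
    using zero k by (auto simp: C_def Q_def total_content_def Q10)
  then have x0: "0 < x" "x \<le> 1/2" using x by auto
  have Q: "1 \<le> Q" "Q \<le> 2"
    using total_content_bounds[OF adm x] k by (auto simp: tc)
  have t: "0 < t" "t < 1" using \<theta> m by (auto simp: t_def m_def field_simps)
  have "0.7 * (Q - C) \<le> (2 - t) / 2 * (p + q) - C"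
  proof (rule normalised_half_welfare_ge[OF x0 _ Q(2) t _ _ _ _ zero])
    show "0 < Q" using Q by simp
    have "Q1 (1 - x) \<le> Q1 1" using mono_onD[OF mono, of "1 - x" 1] x0 by simp
    then show "Q - 1 \<le> p" using k by (simp add: pk')
    show "(1 - 2 * x) * q \<ge> 1/2 * p + (1/2 - 2 * x) * (Q - p)" if "x \<le> 1/4"
    proof -
      \<comment> \<open>Here \<open>x \<le> 1/2 - x \<le> 1 - x\<close>, so concavity interpolates
        between the outer points.\<close>
      have "1/2 * Q1 x + (1/2 - 2 * x) * Q1 (1 - x) \<le> (1/2 + (1/2 - 2 * x)) * Q1 (1/2 - x)"
        using that x0 by (intro concave_on_weighted[OF conc]) (auto simp: field_simps)
      from this[unfolded pk pk']
      have "(1/2 * p + (1/2 - 2 * x) * (Q - p)) * Q1 1 \<le> ((1 - 2 * x) * q) * Q1 1"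
        by (simp add: field_simps)
      then show ?thesis using k by (simp only: mult_le_cancel_right_pos)
    qed
    show "x * q \<ge> (1/2 - x) * p" if "1/4 \<le> x"
    proof -
      \<comment> \<open>Now \<open>1/2 - x \<le> x\<close>, so the interpolation is between 0 and
        \<open>x\<close>.\<close>
      have "(1/2 - x) * Q1 x + (2 * x - 1/2) * Q1 0 \<le> ((1/2 - x) + (2 * x - 1/2)) * Q1 (1/2 - x)"
        using that x0 by (intro concave_on_weighted[OF conc]) (auto simp: field_simps)
      from this[unfolded pk Q10]
      have "((1/2 - x) * p) * Q1 1 \<le> (x * q) * Q1 1"
        by (simp add: field_simps)
      then show ?thesis using k by (simp only: mult_le_cancel_right_pos)
    qed
    show "t * Q < C"
    proof (rule ccontr)
      \<comment> \<open>Then \<open>a = 1\<close> is feasible at \<open>x\<close> and yields the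
        whole welfare \<open>Q - C\<close>.\<close>
      assume "\<not> t * Q < C"
      then have "(x * (2 - t) + ((1/2 - x) * (2 - t) + t / 2) * 1) * Q - C < 0.7 * (Q - C)"
        using x0 by (intro fullx) auto
      moreover have "x * (2 - t) + ((1/2 - x) * (2 - t) + t / 2) * 1 = 1"
        by (simp add: field_simps)
      ultimately have "Q - C < 0.7 * (Q - C)" by (simp only: mult_1_left)
      then show False using zero by (simp add: field_simps)
    qed
    show "(1 - t) * a * Q < 0.7 * (Q - C)"
      if a: "0 \<le> a" "a \<le> 1" and eq: "t * a * Q + (1 - a) * (2 - t) * x * Q = C" for a
    proof -
      have "(x * (2 - t) + ((1/2 - x) * (2 - t) + t / 2) * a) * Q - C = (1 - t) * a * Q"
        by (simp flip: eq add: field_simps)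
      then show ?thesis using fullx[OF x0(1) a] eq by simp
    qed
  qed
  with halfx show False by simp
qed

theorem proposition5:
  shows "PoA_ag \<ge> 0.7"
  unfolding PoA_ag_def
proof (rule cInf_greatest[OF instance_ratios_nonempty])
  fix r assume "r \<in> instance_ratios"
  then obtain \<theta>1 \<theta>2 cH Q1 where r: "r = SW_ag \<theta>1 \<theta>2 cH Q1 / SW_opt \<theta>1 \<theta>2 cH Q1"
    and A: "0 < \<theta>1" "\<theta>1 < \<theta>2" "0 < cH" "admissible_Q1 Q1"
    by (auto simp: instance_ratios_def)
  obtain x where x: "x \<in> {0..1}"
    and opt: "SW_opt \<theta>1 \<theta>2 cH Q1 = (\<theta>1 + \<theta>2) / 2 * total_content Q1 x 1 - x * cH"
    using SW_opt_attained[OF A(4)] by blast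
  \<comment> \<open>total content is symmetric about \<open>1/2\<close>, so moving to \<open>y \<le> 1/2\<close> only saves cost\<close>
  define y where "y = min x (1 - x)"
  have y: "y \<in> {0..1/2}" "y \<le> x" using x by (auto simp: y_def min_def)
  have "total_content Q1 y 1 = total_content Q1 x 1"
    by (auto simp: y_def min_def total_content_def)
  then have "SW_opt \<theta>1 \<theta>2 cH Q1 \<le> (\<theta>1 + \<theta>2) / 2 * total_content Q1 y 1 - y * cH"
    using opt y A(3) by simp
  then have "0.7 * SW_opt \<theta>1 \<theta>2 cH Q1 \<le>
      0.7 * ((\<theta>1 + \<theta>2) / 2 * total_content Q1 y 1 - y * cH)"
    by simp
  also have "\<dots> \<le> SW_ag \<theta>1 \<theta>2 cH Q1" by (rule SW_ag_approx[OF A y(1)])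
  finally have "0.7 * SW_opt \<theta>1 \<theta>2 cH Q1 \<le> SW_ag \<theta>1 \<theta>2 cH Q1" .
  then show "0.7 \<le> r"
    using SW_opt_pos[OF A(1,2,4), of cH] by (simp add: r pos_le_divide_eq)
qed

end
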